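(* Let $\mathcal{R}$ be an associative ring with unit $1\neq 0$, let $a,x\in\mathcal{R}$, let $\mathcal{S}$ be a right ideal of $\mathcal{R}$ and let $\mathcal{S}'$ be a left ideal of $\mathcal{R}$. Then the following assertions are equivalent: (1) $x=a^{(1,2)}_{{\rm rprin}=\mathcal{S},{\rm lprin}=\mathcal{S}'}$, i.e. $x\in a\{1,2\}$, $x\mathcal{R}=\mathcal{S}$ and $\mathcal{R}x=\mathcal{S}'$. (2) $\varphi_{xa}=\rho_{\mathcal{S},\,{\rm rann}(a)}$, ${}_{ax}\varphi=\rho_{\mathcal{S}',\,{\rm lann}(a)}$ and $x\in\mathcal{S}\cup\mathcal{S}'$. (3) $\varphi_{xa}=\rho_{\mathcal{S},\,{\rm rann}(a)}$, ${}_{ax}\varphi=\rho_{\mathcal{S}',\,{\rm lann}(a)}$ and ${\rm lann}(\mathcal{S})\subseteq{\rm lann}(x)$. (4) $\varphi_{xa}=\rho_{\mathcal{S},\,{\rm rann}(a)}$, ${}_{ax}\varphi=\rho_{\mathcal{S}',\,{\rm lann}(a)}$ and ${\rm rann}(\mathcal{S}')\subseteq{\rm rann}(x)$. (5) $x\in a\{1\}$, $xa\mathcal{R}=\mathcal{S}$, $\mathcal{R}ax=\mathcal{S}'$, and $x\in\mathcal{S}\cup\mathcal{S}'$. (6) $x\in a\{1\}$, $xa\mathcal{R}=\mathcal{S}$, $\mathcal{R}ax=\mathcal{S}'$, and ${\rm lann}(\mathcal{S})\subseteq{\rm lann}(x)$. (7) $x\in a\{1\}$, $xa\mathcal{R}=\mathcal{S}$,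 $\mathcal{R}ax=\mathcal{S}'$, and ${\rm rann}(\mathcal{S}')\subseteq{\rm rann}(x)$. (8) $a\{1\}\neq\emptyset$ and $x=\rho_{\mathcal{S},\,{\rm rann}(a)}(1)\,a^{(1)}\,\rho_{\mathcal{S}',\,{\rm lann}(a)}(1)$ for some $a^{(1)}\in a\{1\}$.
   Context: Notation: $a\{1\}=\{x\in\mathcal{R}:axa=a\}$, $a\{1,2\}=\{x\in\mathcal{R}:axa=a,\ xax=x\}$; $a\mathcal{R}=\{ar:r\in\mathcal{R}\}$, $\mathcal{R}a=\{ra:r\in\mathcal{R}\}$, ${\rm rann}(a)=\{r:ar=0\}$, ${\rm lann}(a)=\{r:ra=0\}$, and for $\mathcal{A}\subseteq\mathcal{R}$, ${\rm rann}(\mathcal{A})=\{r\in\mathcal{R}:ar=0\ \forall a\in\mathcal{A}\}$, ${\rm lann}(\mathcal{A})=\{r\in\mathcal{R}:ra=0\ \forall a\in\mathcal{A}\}$. The additive group endomorphisms $\varphi_a,{}_a\varphi$ of $\mathcal{R}$ are $\varphi_a(r)=ar$, ${}_a\varphi(r)=ra$. For additive subgroups $\mathcal{S},\mathcal{T}$ of $\mathcal{R}$, $\mathcal{R}=\mathcal{S}\oplus\mathcal{T}$ means $\mathcal{R}=\mathcal{S}+\mathcal{T}$ and $\mathcal{S}\cap\mathcal{T}=\{0\}$; in that case $\rho_{\mathcal{S},\mathcal{T}}:\mathcal{R}\to\mathcal{R}$ is the group endomorphism $\rho_{\mathcal{S},\mathcal{T}}(s+t)=s$ for $s\in\mathcal{S}$,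 $t\in\mathcal{T}$. Convention: whenever $\rho_{\mathcal{S},\mathcal{T}}$ is written, it is implicitly asserted that $\mathcal{R}=\mathcal{S}\oplus\mathcal{T}$; thus (2), (3), (4) and (8) each include the assertions $\mathcal{R}=\mathcal{S}\oplus{\rm rann}(a)$ and $\mathcal{R}=\mathcal{S}'\oplus{\rm lann}(a)$. *)

theory Defs
  imports Main "HOL-Library.Set_Algebras"
begin

text \<open>The ambient ring is the type itself: class \<open>ring_1\<close> is exactly the class of associative,
  not necessarily commutative rings with unit satisfying \<open>0 \<noteq> 1\<close>.\<close>

definition additive_subgroup :: "'a::ring_1 set \<Rightarrow> bool" where
  "additive_subgroup S \<longleftrightarrow> 0 \<in> S \<and> (\<forall>s\<in>S. \<forall>t\<in>S. s + t \<in> S) \<and> (\<forall>s\<in>S. - s \<in> S)"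

definition right_ideal :: "'a::ring_1 set \<Rightarrow> bool" where
  "right_ideal S \<longleftrightarrow> additive_subgroup S \<and> (\<forall>s\<in>S. \<forall>r. s * r \<in> S)"

definition left_ideal :: "'a::ring_1 set \<Rightarrow> bool" where
  "left_ideal S \<longleftrightarrow> additive_subgroup S \<and> (\<forall>s\<in>S. \<forall>r. r * s \<in> S)"

definition inv1 :: "'a::ring_1 \<Rightarrow> 'a set" where
  "inv1 a = {x. a * x * a = a}"

definition inv12 :: "'a::ring_1 \<Rightarrow> 'a set" where
  "inv12 a = {x. a * x * a = a \<and> x * a * x = x}"

definition rprin :: "'a::ring_1 \<Rightarrow> 'a set" where
  "rprin a = {a * r | r. True}"

definition lprin :: "'a::ring_1 \<Rightarrow> 'a set" where
  "lprin a = {r * a | r. True}"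

definition rann :: "'a::ring_1 \<Rightarrow> 'a set" where
  "rann a = {r. a * r = 0}"

definition lann :: "'a::ring_1 \<Rightarrow> 'a set" where
  "lann a = {r. r * a = 0}"

definition rann_set :: "'a::ring_1 set \<Rightarrow> 'a set" where
  "rann_set A = {r. \<forall>a\<in>A. a * r = 0}"

definition lann_set :: "'a::ring_1 set \<Rightarrow> 'a set" where
  "lann_set A = {r. \<forall>a\<in>A. r * a = 0}"

definition lmul :: "'a::ring_1 \<Rightarrow> 'a \<Rightarrow> 'a" where
  "lmul a = (\<lambda>r. a * r)"

definition rmul :: "'a::ring_1 \<Rightarrow> 'a \<Rightarrow> 'a" where
  "rmul a = (\<lambda>r. r * a)"

text \<open>Here \<open>S + T\<close> is the elementwise sum of sets.\<close>

definition direct_sum :: "'a::ring_1 set \<Rightarrow> 'a set \<Rightarrow> bool" where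
  "direct_sum S T \<longleftrightarrow> S + T = UNIV \<and> S \<inter> T = {0}"

text \<open>\<open>proj S T\<close> sends \<open>s + t\<close> to \<open>s\<close>. It is meaningful only if \<open>S\<close> and \<open>T\<close> are additive
  subgroups with \<open>direct_sum S T\<close>; that condition has to be asserted separately wherever
  \<open>proj\<close> is used.\<close>

definition proj :: "'a::ring_1 set \<Rightarrow> 'a set \<Rightarrow> 'a \<Rightarrow> 'a" where
  "proj S T r = (THE s. s \<in> S \<and> (\<exists>t\<in>T. r = s + t))"

lemma proj_add:
  assumes "additive_subgroup S" "additive_subgroup T" "direct_sum S T" "s \<in> S" "t \<in> T"
  shows "proj S T (s + t) = s"
  unfolding proj_def
proof (rule the_equality)
  show "s \<in> S \<and> (\<exists>t'\<in>T. s + t = s + t')" using assms by blast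
next
  fix s' assume "s' \<in> S \<and> (\<exists>t'\<in>T. s + t = s' + t')"
  then obtain t' where h: "s' \<in> S" "t' \<in> T" "s + t = s' + t'" by blast
  have "s' + - s \<in> S" "t + - t' \<in> T"
    using assms h unfolding additive_subgroup_def by blast+
  moreover have "s' + - s = t + - t'" using h(3) by (metis add_diff_cancel_left' add_diff_eq diff_add_eq diff_conv_add_uminus add.commute)
  ultimately have "s' + - s \<in> S \<inter> T" by simp
  then have "s' + - s = 0" using assms(3) by (simp only: direct_sum_def singleton_iff)
  then show "s' = s" by simp
qed

definition tfae :: "bool list \<Rightarrow> bool" where
  "tfae Ps \<longleftrightarrow> (\<forall>P\<in>set Ps. \<forall>Q\<in>set Ps. P \<longleftrightarrow> Q)"

end

theory Submission
  imports Defs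
begin

text \<open>
  If \<open>x\<close> is an inner inverse of \<open>a\<close>, then \<open>e = x * a\<close> and \<open>f = a * x\<close> are idempotents with
  \<open>rann e = rann a\<close> and \<open>lann f = lann a\<close>. The Peirce decompositions \<open>R = e R \<oplus> rann e\<close> and
  \<open>R = R f \<oplus> lann f\<close> then say that left multiplication by \<open>e\<close> is the projection onto \<open>e R\<close> along
  \<open>rann a\<close>, and right multiplication by \<open>f\<close> the projection onto \<open>R f\<close> along \<open>lann a\<close>. Conversely,
  if left multiplication by \<open>x * a\<close> is a projection along \<open>rann a\<close>, then
  \<open>x * a - 1 \<in> rann a\<close>, that is, \<open>a * x * a = a\<close>. Hence the description of \<open>x\<close> by projections and
  the one by an inner inverse with prescribed \<open>x * a * R = S\<close> and \<open>R * a * x = S'\<close> are the same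
  (\<open>lmul_eq_proj_iff\<close>, \<open>rmul_eq_proj_iff\<close>).

  What this leaves open is whether also \<open>x * a * x = x\<close>. Since \<open>S = e R\<close> is the set of elements
  that \<open>e\<close> fixes from the left, and \<open>S' = R f\<close> the set of those that \<open>f\<close> fixes from the right,
  each of the side conditions (\<open>x \<in> S \<union> S'\<close>, the two inclusions of annihilators) says just this
  (\<open>idempotent_left_fixed_iff\<close>, \<open>idempotent_right_fixed_iff\<close>).

  For the explicit formula, the projection onto a right ideal along a right annihilator is
  right-linear, so it is left multiplication by its value \<open>p\<close> at \<open>1\<close>, and symmetrically on the
  left with value \<open>q\<close>. For an inner inverse \<open>b\<close> of \<open>a\<close>, the element \<open>x = p * b * q\<close> satisfies
  \<open>x * a = p\<close> and \<open>a * x = q\<close>, whatever \<open>b\<close> is; so \<open>x\<close> has the required projections, and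
  \<open>x * a * x = p * x = x\<close> because \<open>p\<close> is idempotent.
\<close>

section \<open>Projections of a direct sum\<close>

lemma direct_sum_decompose:
  assumes "direct_sum S T"
  obtains s t where "s \<in> S" "t \<in> T" "r = s + t"
  using assms unfolding direct_sum_def by (metis UNIV_I set_plus_elim)

lemma additive_subgroup_rann: "additive_subgroup (rann a)"
  unfolding additive_subgroup_def rann_def by (simp add: distrib_left)

lemma additive_subgroup_lann: "additive_subgroup (lann a)"
  unfolding additive_subgroup_def lann_def by (simp add: distrib_right)

lemma proj_in:
  assumes "additive_subgroup S" "additive_subgroup T" "direct_sum S T"
  shows "proj S T r \<in> S"
  using assms by (metis direct_sum_decompose proj_add)

lemma diff_proj_in:
  assumes "additive_subgroup S" "additive_subgroup T" "direct_sum S T"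
  shows "r - proj S T r \<in> T"
  using assms by (metis direct_sum_decompose proj_add add_diff_cancel_left')

lemma proj_eqI:
  assumes "additive_subgroup S" "additive_subgroup T" "direct_sum S T"
    and "\<And>r. f r \<in> S" "\<And>r. r - f r \<in> T"
  shows "proj S T = f"
proof
  fix r
  have "proj S T (f r + (r - f r)) = f r"
    using assms by (intro proj_add)
  then show "proj S T r = f r" by simp
qed

section \<open>Projections onto one-sided ideals along annihilators\<close>

text \<open>The decomposition \<open>1 = p + (1 - p)\<close> multiplied by \<open>r\<close> from the right is the decomposition
  of \<open>r\<close>, since both summands are right ideals.\<close>

lemma proj_rann_eq_lmul:
  assumes "right_ideal S" and "direct_sum S (rann a)"
  shows "proj S (rann a) = lmul (proj S (rann a) 1)"
proof (rule proj_eqI)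
  let ?p = "proj S (rann a) 1"
  show S: "additive_subgroup S" using assms(1) by (simp add: right_ideal_def)
  show "lmul ?p r \<in> S" for r
    using assms proj_in[OF S additive_subgroup_rann] by (simp add: right_ideal_def lmul_def)
  have "1 - ?p \<in> rann a" using diff_proj_in[OF S additive_subgroup_rann assms(2)] .
  then have "a * ?p = a" by (simp add: rann_def right_diff_distrib)
  then show "r - lmul ?p r \<in> rann a" for r
    by (simp add: rann_def lmul_def right_diff_distrib flip: mult.assoc)
qed (use assms additive_subgroup_rann in auto)

lemma proj_lann_eq_rmul:
  assumes "left_ideal S" and "direct_sum S (lann a)"
  shows "proj S (lann a) = rmul (proj S (lann a) 1)"
proof (rule proj_eqI)
  let ?q = "proj S (lann a) 1"
  show S: "additive_subgroup S" using assms(1) by (simp add: left_ideal_def)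
  show "rmul ?q r \<in> S" for r
    using assms proj_in[OF S additive_subgroup_lann] by (simp add: left_ideal_def rmul_def)
  have "1 - ?q \<in> lann a" using diff_proj_in[OF S additive_subgroup_lann assms(2)] .
  then have "?q * a = a" by (simp add: lann_def left_diff_distrib)
  then show "r - rmul ?q r \<in> lann a" for r
    by (simp add: lann_def rmul_def left_diff_distrib mult.assoc)
qed (use assms additive_subgroup_lann in auto)

section \<open>Idempotents\<close>

text \<open>The element \<open>1 - e\<close> annihilates \<open>e R\<close> from the left, so the inclusion of annihilators
  forces \<open>(1 - e) * x = 0\<close>.\<close>

lemma idempotent_left_fixed_iff:
  fixes e x :: "'a::ring_1"
  assumes "e * e = e"
  shows "x \<in> rprin e \<longleftrightarrow> e * x = x"
    and "lann_set (rprin e) \<subseteq> lann x \<longleftrightarrow> e * x = x"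
proof -
  show fixed: "x \<in> rprin e \<longleftrightarrow> e * x = x"
    unfolding rprin_def using assms by (auto simp flip: mult.assoc) metis
  show "lann_set (rprin e) \<subseteq> lann x \<longleftrightarrow> e * x = x"
  proof
    assume "lann_set (rprin e) \<subseteq> lann x"
    moreover have "1 - e \<in> lann_set (rprin e)"
      using assms by (auto simp: lann_set_def rprin_def left_diff_distrib simp flip: mult.assoc)
    ultimately show "e * x = x" by (auto simp: lann_def left_diff_distrib)
  next
    assume "e * x = x"
    then show "lann_set (rprin e) \<subseteq> lann x"
      using fixed by (auto simp: lann_set_def lann_def)
  qed
qed

lemma idempotent_right_fixed_iff:
  fixes f x :: "'a::ring_1"
  assumes "f * f = f"
  shows "x \<in> lprin f \<longleftrightarrow> x * f = x"
    and "rann_set (lprin f) \<subseteq> rann x \<longleftrightarrow> x * f = x"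
proof -
  show fixed: "x \<in> lprin f \<longleftrightarrow> x * f = x"
    unfolding lprin_def using assms by (auto simp: mult.assoc) metis
  show "rann_set (lprin f) \<subseteq> rann x \<longleftrightarrow> x * f = x"
  proof
    assume "rann_set (lprin f) \<subseteq> rann x"
    moreover have "1 - f \<in> rann_set (lprin f)"
      using assms by (auto simp: rann_set_def lprin_def right_diff_distrib mult.assoc)
    ultimately show "x * f = x" by (auto simp: rann_def right_diff_distrib)
  next
    assume "x * f = x"
    then show "rann_set (lprin f) \<subseteq> rann x"
      using fixed by (auto simp: rann_set_def rann_def)
  qed
qed

lemma direct_sum_idempotent_right:
  fixes e :: "'a::ring_1"
  assumes "e * e = e"
  shows "direct_sum (rprin e) (rann e)"
proof -
  have "r \<in> rprin e + rann e" for r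
  proof -
    have "e * r + (r - e * r) \<in> rprin e + rann e"
      using assms by (intro set_plus_intro)
        (auto simp: rprin_def rann_def right_diff_distrib simp flip: mult.assoc)
    then show ?thesis by simp
  qed
  moreover have "rprin e \<inter> rann e = {0}"
    by (auto simp: idempotent_left_fixed_iff(1)[OF assms] rann_def)
  ultimately show ?thesis by (auto simp: direct_sum_def)
qed

lemma direct_sum_idempotent_left:
  fixes f :: "'a::ring_1"
  assumes "f * f = f"
  shows "direct_sum (lprin f) (lann f)"
proof -
  have "r \<in> lprin f + lann f" for r
  proof -
    have "r * f + (r - r * f) \<in> lprin f + lann f"
      using assms by (intro set_plus_intro)
        (auto simp: lprin_def lann_def left_diff_distrib mult.assoc)
    then show ?thesis by simp
  qed
  moreover have "lprin f \<inter> lann f = {0}"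
    by (auto simp: idempotent_right_fixed_iff(1)[OF assms] lann_def)
  ultimately show ?thesis by (auto simp: direct_sum_def)
qed

section \<open>Inner inverses\<close>

lemma inv1_idempotents:
  assumes "x \<in> inv1 a"
  shows "(x * a) * (x * a) = x * a" and "(a * x) * (a * x) = a * x"
proof -
  have a: "a * x * a = a" using assms by (simp add: inv1_def)
  have "(x * a) * (x * a) = x * (a * x * a)" by (simp only: mult.assoc)
  then show "(x * a) * (x * a) = x * a" by (simp only: a)
  have "(a * x) * (a * x) = (a * x * a) * x" by (simp only: mult.assoc)
  then show "(a * x) * (a * x) = a * x" by (simp only: a)
qed

lemma inv1_annihilators:
  assumes "x \<in> inv1 a"
  shows "rann (x * a) = rann a" and "lann (a * x) = lann a"
proof -
  have a: "a * x * a = a" using assms by (simp add: inv1_def)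
  have "a * r = 0" if "x * a * r = 0" for r
    using a that by (metis mult.assoc mult_zero_right)
  then show "rann (x * a) = rann a" by (auto simp: rann_def mult.assoc)
  have "r * a = 0" if "r * (a * x) = 0" for r
    using a that by (metis mult.assoc mult_zero_left)
  then show "lann (a * x) = lann a" by (auto simp: lann_def simp flip: mult.assoc)
qed

text \<open>From left to right, evaluating the projection at \<open>1\<close> gives \<open>a * (1 - x * a) = 0\<close>, and
  \<open>S\<close> is the range of the projection. From right to left this is the decomposition of the ring
  by the idempotent \<open>x * a\<close>.\<close>

lemma lmul_eq_proj_iff:
  assumes "right_ideal S"
  shows "direct_sum S (rann a) \<and> lmul (x * a) = proj S (rann a)
    \<longleftrightarrow> x \<in> inv1 a \<and> rprin (x * a) = S"
proof
  assume L: "direct_sum S (rann a) \<and> lmul (x * a) = proj S (rann a)"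
  have S: "additive_subgroup S" using assms by (simp add: right_ideal_def)
  have proj: "proj S (rann a) r = x * a * r" for r
    using L by (metis lmul_def)
  have "1 - x * a \<in> rann a"
    using diff_proj_in[OF S additive_subgroup_rann, of a 1] L proj by simp
  then have "x \<in> inv1 a"
    by (simp add: inv1_def rann_def right_diff_distrib mult.assoc)
  moreover have "rprin (x * a) \<subseteq> S"
  proof
    fix s assume "s \<in> rprin (x * a)"
    then obtain r where "s = proj S (rann a) r" using proj by (auto simp: rprin_def)
    then show "s \<in> S" using proj_in[OF S additive_subgroup_rann] L by simp
  qed
  moreover have "S \<subseteq> rprin (x * a)"
  proof
    fix s assume "s \<in> S"
    then have "proj S (rann a) (s + 0) = s"
      using L S additive_subgroup_rann by (intro proj_add) (auto simp: rann_def)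
    then have "s = x * a * s" using proj by simp
    then show "s \<in> rprin (x * a)" by (auto simp: rprin_def)
  qed
  ultimately show "x \<in> inv1 a \<and> rprin (x * a) = S" by blast
next
  assume R: "x \<in> inv1 a \<and> rprin (x * a) = S"
  have sum: "direct_sum S (rann a)"
    using direct_sum_idempotent_right[of "x * a"] inv1_idempotents inv1_annihilators R by metis
  have "proj S (rann a) = lmul (x * a)"
  proof (rule proj_eqI)
    show "lmul (x * a) r \<in> S" for r using R by (auto simp: lmul_def rprin_def)
    show "r - lmul (x * a) r \<in> rann a" for r
      using R by (simp add: inv1_def rann_def lmul_def right_diff_distrib flip: mult.assoc)
  qed (use assms sum additive_subgroup_rann in \<open>auto simp: right_ideal_def\<close>)
  with sum show "direct_sum S (rann a) \<and> lmul (x * a) = proj S (rann a)" by simp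
qed

lemma rmul_eq_proj_iff:
  assumes "left_ideal S"
  shows "direct_sum S (lann a) \<and> rmul (a * x) = proj S (lann a)
    \<longleftrightarrow> x \<in> inv1 a \<and> lprin (a * x) = S"
proof
  assume L: "direct_sum S (lann a) \<and> rmul (a * x) = proj S (lann a)"
  have S: "additive_subgroup S" using assms by (simp add: left_ideal_def)
  have proj: "proj S (lann a) r = r * (a * x)" for r
    using L by (metis rmul_def)
  have "1 - a * x \<in> lann a"
    using diff_proj_in[OF S additive_subgroup_lann, of a 1] L proj by simp
  then have "x \<in> inv1 a"
    by (simp add: inv1_def lann_def left_diff_distrib)
  moreover have "lprin (a * x) \<subseteq> S"
  proof
    fix s assume "s \<in> lprin (a * x)"
    then obtain r where "s = proj S (lann a) r" using proj by (auto simp: lprin_def)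
    then show "s \<in> S" using proj_in[OF S additive_subgroup_lann] L by simp
  qed
  moreover have "S \<subseteq> lprin (a * x)"
  proof
    fix s assume "s \<in> S"
    then have "proj S (lann a) (s + 0) = s"
      using L S additive_subgroup_lann by (intro proj_add) (auto simp: lann_def)
    then have "s = s * (a * x)" using proj by simp
    then show "s \<in> lprin (a * x)" unfolding lprin_def by blast
  qed
  ultimately show "x \<in> inv1 a \<and> lprin (a * x) = S" by blast
next
  assume R: "x \<in> inv1 a \<and> lprin (a * x) = S"
  have sum: "direct_sum S (lann a)"
    using direct_sum_idempotent_left[of "a * x"] inv1_idempotents inv1_annihilators R by metis
  have "proj S (lann a) = rmul (a * x)"
  proof (rule proj_eqI)
    show "rmul (a * x) r \<in> S" for r using R by (auto simp: rmul_def lprin_def)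
    show "r - rmul (a * x) r \<in> lann a" for r
      using R by (simp add: inv1_def lann_def rmul_def left_diff_distrib mult.assoc)
  qed (use assms sum additive_subgroup_lann in \<open>auto simp: left_ideal_def\<close>)
  with sum show "direct_sum S (lann a) \<and> rmul (a * x) = proj S (lann a)" by simp
qed

lemma rprin_mult_le: "rprin (x * y) \<subseteq> rprin x"
  by (auto simp: rprin_def mult.assoc)

lemma lprin_mult_le: "lprin (y * x) \<subseteq> lprin x"
  by (auto simp: lprin_def simp flip: mult.assoc)

lemma outer_inverse_principal_ideals:
  assumes "x * a * x = x"
  shows "rprin (x * a) = rprin x" and "lprin (a * x) = lprin x"
  using assms rprin_mult_le[of x a] rprin_mult_le[of "x * a" x]
    lprin_mult_le[of a x] lprin_mult_le[of x "a * x"]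
  by (simp_all add: mult.assoc)

text \<open>Write \<open>p\<close> and \<open>q\<close> for the values of the two projections at \<open>1\<close>. Since \<open>b * a - 1\<close> and
  \<open>p - 1\<close> lie in \<open>rann a\<close>, which left multiplication by \<open>p\<close> kills, \<open>p * b * a = p = p * p\<close>;
  likewise \<open>a * b * q = q\<close>. With \<open>q * a = a\<close> and \<open>a * p = a\<close> this gives \<open>x * a = p\<close> and
  \<open>a * x = q\<close>.\<close>

lemma products_of_projected_inner_inverse:
  assumes "right_ideal S" "left_ideal S'"
    and "direct_sum S (rann a)" "direct_sum S' (lann a)"
    and "b \<in> inv1 a"
    and x: "x = proj S (rann a) 1 * b * proj S' (lann a) 1"
  shows "lmul (x * a) = proj S (rann a)" and "rmul (a * x) = proj S' (lann a)"
    and "x * a * x = x"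
proof -
  define p where "p = proj S (rann a) 1"
  define q where "q = proj S' (lann a) 1"
  have S: "additive_subgroup S" and S': "additive_subgroup S'"
    using assms by (simp_all add: right_ideal_def left_ideal_def)
  have ba: "a * b * a = a" using assms(5) by (simp add: inv1_def)
  have P: "proj S (rann a) = lmul p"
    unfolding p_def using assms by (intro proj_rann_eq_lmul)
  have Q: "proj S' (lann a) = rmul q"
    unfolding q_def using assms by (intro proj_lann_eq_rmul)
  have p_kills: "p * t = 0" if "t \<in> rann a" for t
    using proj_add[OF S additive_subgroup_rann assms(3), of 0 t] that S P
    by (simp add: additive_subgroup_def lmul_def)
  have q_kills: "t * q = 0" if "t \<in> lann a" for t
    using proj_add[OF S' additive_subgroup_lann assms(4), of 0 t] that S' Q
    by (simp add: additive_subgroup_def rmul_def)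
  have one_p: "1 - p \<in> rann a"
    unfolding p_def using S additive_subgroup_rann assms(3) by (rule diff_proj_in)
  have one_q: "1 - q \<in> lann a"
    unfolding q_def using S' additive_subgroup_lann assms(4) by (rule diff_proj_in)
  have ap: "a * p = a" using one_p by (simp add: rann_def right_diff_distrib)
  have qa: "q * a = a" using one_q by (simp add: lann_def left_diff_distrib)
  have pp: "p * p = p" using p_kills[OF one_p] by (simp add: right_diff_distrib)
  have pba: "p * (b * a) = p"
    using p_kills[of "1 - b * a"] ba by (simp add: rann_def right_diff_distrib mult.assoc)
  have abq: "a * b * q = q"
    using q_kills[of "1 - a * b"] ba by (simp add: lann_def left_diff_distrib)
  have x': "x = p * b * q" using x by (simp add: p_def q_def)
  have xa: "x * a = p" using x' qa pba by (simp add: mult.assoc)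
  have ax: "a * x = q" using x' ap abq by (simp flip: mult.assoc)
  show "lmul (x * a) = proj S (rann a)" using xa P by simp
  show "rmul (a * x) = proj S' (lann a)" using ax Q by simp
  have "p * x = x" using x' pp by (simp flip: mult.assoc)
  then show "x * a * x = x" using xa by simp
qed

section \<open>The equivalence\<close>

lemma tfaeI:
  assumes "\<forall>P\<in>set Ps. P \<longleftrightarrow> C"
  shows "tfae Ps"
  using assms unfolding tfae_def by blast

theorem theorem6p3:
  fixes a x :: "'a::ring_1" and S S' :: "'a set"
  assumes "right_ideal S" and "left_ideal S'"
  shows "tfae
     [ x \<in> inv12 a \<and> rprin x = S \<and> lprin x = S',
       direct_sum S (rann a) \<and> direct_sum S' (lann a) \<and>
        lmul (x * a) = proj S (rann a) \<and> rmul (a * x) = proj S' (lann a) \<and>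
        x \<in> S \<union> S',
       direct_sum S (rann a) \<and> direct_sum S' (lann a) \<and>
        lmul (x * a) = proj S (rann a) \<and> rmul (a * x) = proj S' (lann a) \<and>
        lann_set S \<subseteq> lann x,
       direct_sum S (rann a) \<and> direct_sum S' (lann a) \<and>
        lmul (x * a) = proj S (rann a) \<and> rmul (a * x) = proj S' (lann a) \<and>
        rann_set S' \<subseteq> rann x,
       x \<in> inv1 a \<and> rprin (x * a) = S \<and> lprin (a * x) = S' \<and> x \<in> S \<union> S',
       x \<in> inv1 a \<and> rprin (x * a) = S \<and> lprin (a * x) = S' \<and> lann_set S \<subseteq> lann x,
       x \<in> inv1 a \<and> rprin (x * a) = S \<and> lprin (a * x) = S' \<and> rann_set S' \<subseteq> rann x,
       direct_sum S (rann a) \<and> direct_sum S' (lann a) \<and>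
        inv1 a \<noteq> {} \<and>
        (\<exists>b\<in>inv1 a. x = proj S (rann a) 1 * b * proj S' (lann a) 1) ]"
proof -
  define K where "K \<longleftrightarrow> x \<in> inv1 a \<and> rprin (x * a) = S \<and> lprin (a * x) = S'"
  define D where "D \<longleftrightarrow> direct_sum S (rann a) \<and> direct_sum S' (lann a) \<and>
    lmul (x * a) = proj S (rann a) \<and> rmul (a * x) = proj S' (lann a)"
  define C where "C \<longleftrightarrow> K \<and> x * a * x = x"
  have DK: "D \<longleftrightarrow> K"
    unfolding D_def K_def
    using lmul_eq_proj_iff[OF assms(1), of a x] rmul_eq_proj_iff[OF assms(2), of a x] by blast
  \<comment> \<open>In terms of the idempotents \<open>x * a\<close> and \<open>a * x\<close>, each condition says that one of them
    fixes \<open>x\<close>, and both ways of fixing \<open>x\<close> are the equation \<open>x * a * x = x\<close>.\<close>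
  have side: "x \<in> S \<union> S' \<longleftrightarrow> x * a * x = x" "lann_set S \<subseteq> lann x \<longleftrightarrow> x * a * x = x"
    "rann_set S' \<subseteq> rann x \<longleftrightarrow> x * a * x = x" if K
  proof -
    have e: "x * a * (x * a) = x * a" and f: "a * x * (a * x) = a * x"
      using that inv1_idempotents by (auto simp: K_def)
    have S: "S = rprin (x * a)" and S': "S' = lprin (a * x)" using that by (auto simp: K_def)
    show "x \<in> S \<union> S' \<longleftrightarrow> x * a * x = x"
      using idempotent_left_fixed_iff(1)[OF e, of x] idempotent_right_fixed_iff(1)[OF f, of x]
      unfolding S S' by (simp add: mult.assoc)
    show "lann_set S \<subseteq> lann x \<longleftrightarrow> x * a * x = x"
      unfolding S by (rule idempotent_left_fixed_iff(2)[OF e])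
    show "rann_set S' \<subseteq> rann x \<longleftrightarrow> x * a * x = x"
      unfolding S' using idempotent_right_fixed_iff(2)[OF f, of x] by (simp add: mult.assoc)
  qed
  have one: "x \<in> inv12 a \<and> rprin x = S \<and> lprin x = S' \<longleftrightarrow> C"
    unfolding C_def K_def inv12_def inv1_def using outer_inverse_principal_ideals[of x a] by auto
  have eight: "direct_sum S (rann a) \<and> direct_sum S' (lann a) \<and> inv1 a \<noteq> {} \<and>
      (\<exists>b\<in>inv1 a. x = proj S (rann a) 1 * b * proj S' (lann a) 1) \<longleftrightarrow> C"
    (is "?formula \<longleftrightarrow> _")
  proof
    assume ?formula
    then obtain b where sums: "direct_sum S (rann a)" "direct_sum S' (lann a)"
      and b: "b \<in> inv1 a" "x = proj S (rann a) 1 * b * proj S' (lann a) 1"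
      by blast
    show C
      unfolding C_def DK[symmetric] D_def
      using sums products_of_projected_inner_inverse[OF assms sums b] by simp
  next
    assume C
    then have K: "K \<and> x * a * x = x" by (simp add: C_def)
    then have D: D using DK by simp
    then have "lmul (x * a) 1 = proj S (rann a) 1" "rmul (a * x) 1 = proj S' (lann a) 1"
      by (simp_all add: D_def)
    then have "proj S (rann a) 1 = x * a" "proj S' (lann a) 1 = a * x"
      by (simp_all add: lmul_def rmul_def)
    \<comment> \<open>The inner inverse in the formula can be \<open>x\<close> itself.\<close>
    then have "x = proj S (rann a) 1 * x * proj S' (lann a) 1"
      using K by (simp flip: mult.assoc)
    moreover have "x \<in> inv1 a" using K by (simp add: K_def)
    ultimately show ?formula using D unfolding D_def by blast
  qed
  show ?thesis (is "tfae ?Ps")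
  proof (rule tfaeI)
    have K_side: "K \<and> x \<in> S \<union> S' \<longleftrightarrow> C" "K \<and> lann_set S \<subseteq> lann x \<longleftrightarrow> C"
      "K \<and> rann_set S' \<subseteq> rann x \<longleftrightarrow> C"
      unfolding C_def using side by blast+
    note D_side = K_side[folded DK]
    show "\<forall>P\<in>set ?Ps. P \<longleftrightarrow> C"
      by (simp only: list.set ball_simps one eight
          K_side[unfolded K_def conj_assoc] D_side[unfolded D_def conj_assoc] simp_thms)
  qed
qed

end
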